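(* Let $(X,T)=(X_\alpha,T_\alpha)$ be an odometer, let $p:X\to\mathbb{Z}^+$ be a bounded function such that $S(x)=T^{p(x)}(x)$ defines a homeomorphism $S:X\to X$ (so $S$ is a bounded speedup of $T$ with jump function $p$), and suppose that $S:X\to X$ is minimal. Then $(X,S)$ is topologically conjugate to $(X,T)$. Moreover, $p(x)-c$ is an $S$-coboundary, where $c$ is the orbit number of the speedup.
   Context: Odometers: let $\alpha=\langle\alpha_1,\alpha_2,\ldots\rangle$ be a sequence of integers with every $\alpha_i\ge 2$. $X_\alpha$ is the set of sequences $(x_1,x_2,\ldots)$ with $0\le x_i\le\alpha_i-1$, with the product topology. Addition on $X_\alpha$ is coordinatewise with carrying to the right ($\alpha$-adic addition): $(x_i)+(y_i)=(z_i)$ with $r_1=0$, $z_j=(x_j+y_j+r_j)\bmod\alpha_j$, and for $j\ge2$, $r_j=0$ if $x_{j-1}+y_{j-1}+r_{j-1}<\alpha_{j-1}$ and $r_j=1$ otherwise. The odometer is $T_\alpha(x)=x+(1,0,0,\ldots)$. It is a minimal homeomorphism of a Cantor space. Orbit number: for a bounded speedup $S$ of a minimal homeomorphism $T$ of a Cantor space, there is a constant $c\in\mathbb{Z}^+$ such that every $T$-orbit is the union of exactly $c$ different $S$-orbits; $c$ is called the orbit number. A homeomorphism of $X$ is minimal if all its (two-sided) orbits are dense in $X$. A continuous function $g:X\to\mathbb{R}$ is an $S$-coboundary if $g=f-f\circ S$ for some continuous $f:X\to\mathbb{R}$. *)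

theory Defs
  imports "HOL-Analysis.Analysis"
begin

text \<open>Sequences are indexed from 0, so entry \<open>i\<close> here is entry \<open>i + 1\<close> in one-based notation.\<close>

definition odometer_space :: "(nat \<Rightarrow> nat) \<Rightarrow> (nat \<Rightarrow> nat) topology" where
  "odometer_space \<alpha> = product_topology (\<lambda>i. discrete_topology {..<\<alpha> i}) UNIV"

primrec carry :: "(nat \<Rightarrow> nat) \<Rightarrow> (nat \<Rightarrow> nat) \<Rightarrow> (nat \<Rightarrow> nat) \<Rightarrow> nat \<Rightarrow> nat" where
  "carry \<alpha> x y 0 = 0"
| "carry \<alpha> x y (Suc j) = (if x j + y j + carry \<alpha> x y j < \<alpha> j then 0 else 1)"

definition adic_add :: "(nat \<Rightarrow> nat) \<Rightarrow> (nat \<Rightarrow> nat) \<Rightarrow> (nat \<Rightarrow> nat) \<Rightarrow> nat \<Rightarrow> nat" where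
  "adic_add \<alpha> x y = (\<lambda>j. (x j + y j + carry \<alpha> x y j) mod \<alpha> j)"

definition odometer :: "(nat \<Rightarrow> nat) \<Rightarrow> (nat \<Rightarrow> nat) \<Rightarrow> nat \<Rightarrow> nat" where
  "odometer \<alpha> x = adic_add \<alpha> x (\<lambda>i. if i = 0 then 1 else 0)"

text \<open>The maps below are only meaningful on the carrier \<open>topspace X\<close>; accordingly the inverse of a
  homeomorphism is taken with respect to that carrier.\<close>

definition int_iterate :: "'a topology \<Rightarrow> ('a \<Rightarrow> 'a) \<Rightarrow> int \<Rightarrow> 'a \<Rightarrow> 'a" where
  "int_iterate X f k =
     (if 0 \<le> k then f ^^ nat k else inv_into (topspace X) f ^^ nat (- k))"

definition orbit :: "'a topology \<Rightarrow> ('a \<Rightarrow> 'a) \<Rightarrow> 'a \<Rightarrow> 'a set" where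
  "orbit X f x = range (\<lambda>k. int_iterate X f k x)"

definition minimal_homeomorphism :: "'a topology \<Rightarrow> ('a \<Rightarrow> 'a) \<Rightarrow> bool" where
  "minimal_homeomorphism X f \<longleftrightarrow>
     homeomorphic_map X X f \<and> (\<forall>x\<in>topspace X. X closure_of orbit X f x = topspace X)"

definition is_orbit_number :: "'a topology \<Rightarrow> ('a \<Rightarrow> 'a) \<Rightarrow> ('a \<Rightarrow> 'a) \<Rightarrow> nat \<Rightarrow> bool" where
  "is_orbit_number X T S c \<longleftrightarrow> 0 < c \<and>
     (\<forall>x\<in>topspace X. \<exists>C \<subseteq> orbit X S ` topspace X. finite C \<and> card C = c \<and> orbit X T x = \<Union>C)"

text \<open>Since distinct \<open>S\<close>-orbits are disjoint, there is at most one such \<open>c\<close> on a nonempty space;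
  it exists whenever \<open>S\<close> is a bounded speedup of a minimal homeomorphism of a Cantor space.\<close>

definition orbit_number :: "'a topology \<Rightarrow> ('a \<Rightarrow> 'a) \<Rightarrow> ('a \<Rightarrow> 'a) \<Rightarrow> nat" where
  "orbit_number X T S = (THE c. is_orbit_number X T S c)"

definition coboundary :: "'a topology \<Rightarrow> ('a \<Rightarrow> 'a) \<Rightarrow> ('a \<Rightarrow> real) \<Rightarrow> bool" where
  "coboundary X S g \<longleftrightarrow> continuous_map X euclideanreal g \<and>
     (\<exists>f. continuous_map X euclideanreal f \<and> (\<forall>x\<in>topspace X. g x = f x - f (S x)))"

definition topologically_conjugate ::
  "'a topology \<Rightarrow> ('a \<Rightarrow> 'a) \<Rightarrow> 'b topology \<Rightarrow> ('b \<Rightarrow> 'b) \<Rightarrow> bool" where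
  "topologically_conjugate X f Y g \<longleftrightarrow>
     (\<exists>h. homeomorphic_map X Y h \<and> (\<forall>x\<in>topspace X. h (f x) = g (h x)))"

end

theory Submission
  imports Defs
begin

text \<open>
  Write \<open>Q\<^sub>n\<close> for the product of the first \<open>n\<close> bases and read the first \<open>n\<close> digits of a point as an
  integer modulo \<open>Q\<^sub>n\<close>, its residue.  The odometer \<open>T\<close> is the map that adds \<open>1\<close> to all residues at
  once, and a point is determined by its residues, so \<open>T\<close> is the inverse limit of the rotations by
  \<open>1\<close> of the cyclic groups of order \<open>Q\<^sub>n\<close>.

  Because \<open>T\<close> has no periodic points, \<open>p x = k\<close> says the same as \<open>S x = T\<^sup>k x\<close>, which is a closed
  condition.  The function \<open>p\<close> takes finitely many values, hence its level sets are clopen and, by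
  compactness, \<open>p\<close> is a function of the residue at some level \<open>N\<close> (\<open>jump_level\<close>).  So at every level
  \<open>n \<ge> N\<close> the speedup \<open>S\<close> induces a permutation of the residues, and minimality of \<open>S\<close> makes it a
  single cycle of length \<open>Q\<^sub>n\<close> (\<open>S_cyclic\<close>).  Two maps that act as a full cycle at all high levels are
  conjugate: match the point of the one system that follows \<open>a\<close> steps after the zero sequence,
  up to level \<open>n\<close>, with the corresponding point of the other (\<open>cyclic_conjugate\<close>).

  For the second claim fix \<open>Q = Q\<^sub>N\<close>.  Along \<open>Q\<close> steps of \<open>S\<close> every residue at level \<open>N\<close> is visited
  once, so the sum of the jumps is a constant; it is a multiple \<open>c * Q\<close> of \<open>Q\<close> as the residue
  returns to its start.  In other words \<open>S\<^sup>Q = T\<^bsup>c * Q\<^esup>\<close>.  The sums of \<open>p - c\<close> over a cycle vanish,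
  and averaging the partial sums over one cycle solves the coboundary equation
  (\<open>coboundary_of_zero_cycle_sum\<close>).  Finally \<open>c\<close> is the orbit number: every \<open>S\<close>-orbit inside the
  \<open>T\<close>-orbit of \<open>x\<close> meets the points \<open>T\<^bsup>i * Q\<^esup> x\<close>, among which \<open>S\<close> connects exactly those whose indices
  \<open>i\<close> agree modulo \<open>c\<close> (\<open>orbit_number_of_period\<close>).
\<close>

section \<open>Orbits of bijections\<close>

lemma funpow_mem: "(f ^^ k) x \<in> A" if "f \<in> A \<rightarrow> A" "x \<in> A" for A :: "'a set"
  using that by (induction k) auto

lemma funpow_cancel:
  assumes "inj_on f A" "f \<in> A \<rightarrow> A" "x \<in> A" "y \<in> A" "(f ^^ k) x = (f ^^ k) y"
  shows "x = y"
  using assms(5)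
proof (induction k)
  case (Suc k)
  then have "f ((f ^^ k) x) = f ((f ^^ k) y)" by simp
  then have "(f ^^ k) x = (f ^^ k) y"
    by (rule inj_onD[OF assms(1) _ funpow_mem[OF assms(2,3)] funpow_mem[OF assms(2,4)]])
  then show ?case by (rule Suc.IH)
qed simp

lemma funpow_apply_commute: "(f ^^ i) ((f ^^ j) u) = (f ^^ j) ((f ^^ i) u)"
  by (simp flip: comp_apply[of "f ^^ _"] funpow_add add: add.commute)

text \<open>
  Orbits are defined with the inverse taken on the carrier.  Comparing forward iterates of both points
  avoids negative powers, and makes the orbit relation visibly symmetric.
\<close>
lemma mem_orbit_iff:
  assumes bij: "bij_betw f (topspace X) (topspace X)" and x: "x \<in> topspace X"
  shows "y \<in> orbit X f x \<longleftrightarrow> y \<in> topspace X \<and> (\<exists>m n. (f ^^ m) x = (f ^^ n) y)"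
proof -
  let ?A = "topspace X"
  let ?g = "inv_into ?A f"
  have fA: "f \<in> ?A \<rightarrow> ?A" and inj: "inj_on f ?A"
    using bij by (auto simp: bij_betw_def)
  have gA: "?g \<in> ?A \<rightarrow> ?A"
    using bij by (metis Pi_I bij_betw_def inv_into_into)
  have fg: "(f ^^ n) ((?g ^^ n) u) = u" if "u \<in> ?A" for n u
    using that
  proof (induction n arbitrary: u)
    case (Suc n)
    have *: "f (?g v) = v" if "v \<in> ?A" for v
      using bij that by (metis bij_betw_def f_inv_into_f)
    have "(f ^^ Suc n) ((?g ^^ Suc n) u) = (f ^^ n) (f (?g ((?g ^^ n) u)))"
      by (simp add: funpow_swap1)
    then show ?case
      using * Suc funpow_mem[OF gA] by simp
  qed simp
  show ?thesis
  proof
    assume "y \<in> orbit X f x"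
    then obtain k where y: "y = int_iterate X f k x"
      by (auto simp: orbit_def)
    show "y \<in> ?A \<and> (\<exists>m n. (f ^^ m) x = (f ^^ n) y)"
    proof (cases "0 \<le> k")
      case True
      then have "(f ^^ nat k) x = (f ^^ 0) y" by (simp add: y int_iterate_def)
      then show ?thesis
        using funpow_mem[OF fA x] by (metis funpow_0)
    next
      case False
      then have yg: "y = (?g ^^ nat (- k)) x" by (simp add: y int_iterate_def)
      then have "(f ^^ 0) x = (f ^^ nat (- k)) y" using fg x by simp
      then show ?thesis
        using funpow_mem[OF gA x] yg by blast
    qed
  next
    assume "y \<in> ?A \<and> (\<exists>m n. (f ^^ m) x = (f ^^ n) y)"
    then obtain m n where y: "y \<in> ?A" and eq: "(f ^^ m) x = (f ^^ n) y" by blast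
    show "y \<in> orbit X f x"
    proof (cases "n \<le> m")
      case True
      then have "(f ^^ n) ((f ^^ (m - n)) x) = (f ^^ n) y"
        using eq by (metis funpow_add le_add_diff_inverse o_apply)
      then have "y = (f ^^ (m - n)) x"
        using funpow_cancel[OF inj fA _ y] funpow_mem[OF fA x] by metis
      then have "y = int_iterate X f (int (m - n)) x"
        by (simp add: int_iterate_def)
      then show ?thesis by (auto simp: orbit_def)
    next
      case False
      then have "(f ^^ m) x = (f ^^ m) ((f ^^ (n - m)) y)"
        using eq by (metis funpow_add le_add_diff_inverse nat_le_linear o_apply)
      then have xe: "x = (f ^^ (n - m)) y"
        using funpow_cancel[OF inj fA x] funpow_mem[OF fA y] by metis
      have "(f ^^ (n - m)) ((?g ^^ (n - m)) x) = (f ^^ (n - m)) y"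
        using fg x xe by simp
      then have "y = (?g ^^ (n - m)) x"
        using funpow_cancel[OF inj fA _ y] funpow_mem[OF gA x] by metis
      then have "y = int_iterate X f (- int (n - m)) x"
        using False by (simp add: int_iterate_def nat_minus_as_int)
      then show ?thesis unfolding orbit_def by blast
    qed
  qed
qed

lemma orbit_refl:
  assumes "bij_betw f (topspace X) (topspace X)" "x \<in> topspace X"
  shows "x \<in> orbit X f x"
  using mem_orbit_iff[OF assms, of x] assms(2) by blast

lemma orbit_eqI:
  assumes bij: "bij_betw f (topspace X) (topspace X)"
    and x: "x \<in> topspace X" and yx: "y \<in> orbit X f x"
  shows "orbit X f y = orbit X f x"
proof -
  have y: "y \<in> topspace X" using yx mem_orbit_iff[OF bij x] by blast
  obtain m n where mn: "(f ^^ m) x = (f ^^ n) y"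
    using yx mem_orbit_iff[OF bij x] by blast
  have transfer: "\<exists>a b. (f ^^ a) v = (f ^^ b) w"
    if "(f ^^ m) u = (f ^^ n) v" "(f ^^ a) u = (f ^^ b) w" for u v w m n a b
  proof -
    have "(f ^^ (a + n)) v = (f ^^ a) ((f ^^ m) u)"
      by (simp add: funpow_add that(1))
    also have "\<dots> = (f ^^ (m + b)) w"
      by (simp add: funpow_apply_commute[of a f m] funpow_add that(2))
    finally show ?thesis by blast
  qed
  have "(\<exists>a b. (f ^^ a) x = (f ^^ b) w) \<longleftrightarrow> (\<exists>a b. (f ^^ a) y = (f ^^ b) w)" for w
    using transfer[OF mn] transfer[OF mn[symmetric]] by blast
  then show ?thesis
    using mem_orbit_iff[OF bij x] mem_orbit_iff[OF bij y] by blast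
qed

text \<open>
  Orbits partition the carrier, so a set is the union of at most one family of orbits; this gives
  the uniqueness that the definite description in \<^const>\<open>orbit_number\<close> needs.
\<close>
lemma orbit_number_eqI:
  assumes bij: "bij_betw S (topspace X) (topspace X)" and ne: "topspace X \<noteq> {}"
    and c: "is_orbit_number X T S c"
  shows "orbit_number X T S = c"
  unfolding orbit_number_def
proof (rule the_equality)
  show "is_orbit_number X T S c" by fact
next
  fix d assume d: "is_orbit_number X T S d"
  obtain x where x: "x \<in> topspace X" using ne by blast
  obtain C where C: "C \<subseteq> orbit X S ` topspace X" "card C = c" "orbit X T x = \<Union>C"
    using c x unfolding is_orbit_number_def by blast
  obtain D where D: "D \<subseteq> orbit X S ` topspace X" "card D = d" "orbit X T x = \<Union>D"
    using d x unfolding is_orbit_number_def by blast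
  have sub: "E \<subseteq> F"
    if E: "E \<subseteq> orbit X S ` topspace X" and F: "F \<subseteq> orbit X S ` topspace X"
      and EF: "\<Union>E = \<Union>F" for E F
  proof
    fix O1 assume O1: "O1 \<in> E"
    then obtain u where u: "u \<in> topspace X" "O1 = orbit X S u" using E by blast
    then have "u \<in> \<Union>F" using O1 EF orbit_refl[OF bij] by blast
    then obtain v where v: "v \<in> topspace X" "orbit X S v \<in> F" "u \<in> orbit X S v"
      using F by blast
    then show "O1 \<in> F" using orbit_eqI[OF bij v(1,3)] u by simp
  qed
  have "C = D" using sub C D by (metis subset_antisym)
  then show "d = c" using C D by simp
qed


section \<open>Transitive maps and periodic points\<close>

text \<open>
  Transitivity makes \<open>r\<close> periodic, and its least period \<open>L\<close> is the number of points that its iterates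
  visit, which is all of \<open>A\<close>.
\<close>
lemma transitive_funpow_eq_iff:
  assumes fA: "f \<in> A \<rightarrow> A" and r: "r \<in> A"
    and trans: "\<And>s t. s \<in> A \<Longrightarrow> t \<in> A \<Longrightarrow> \<exists>k. (f ^^ k) s = t"
  shows "(f ^^ a) r = (f ^^ b) r \<longleftrightarrow> a mod card A = b mod card A"
proof -
  obtain j where "(f ^^ j) (f r) = r" using trans[of "f r" r] fA r by auto
  then have ex: "0 < Suc j \<and> (f ^^ Suc j) r = r" by (simp add: funpow_swap1)
  define L where "L = (LEAST l. 0 < l \<and> (f ^^ l) r = r)"
  have L: "0 < L" "(f ^^ L) r = r"
    using LeastI[of "\<lambda>l. 0 < l \<and> (f ^^ l) r = r", OF ex] by (auto simp: L_def)
  have min: "l \<ge> L" if "0 < l" "(f ^^ l) r = r" for l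
    unfolding L_def using that by (intro Least_le) auto
  have modL: "(f ^^ a) r = (f ^^ (a mod L)) r" for a
    using funpow_mod_eq[OF L(2)] by simp
  \<comment> \<open>Pushing an early coincidence forward by \<open>L - b\<close> steps would return to \<open>r\<close> before time \<open>L\<close>.\<close>
  have neq: "(f ^^ a) r \<noteq> (f ^^ b) r" if ab: "a < b" "b < L" for a b
  proof
    assume eq: "(f ^^ a) r = (f ^^ b) r"
    have "(f ^^ (L - b + a)) r = (f ^^ (L - b + b)) r"
      using eq by (simp only: funpow_add o_apply)
    then have "(f ^^ (L - b + a)) r = r" using L ab by simp
    then show False using min[of "L - b + a"] ab by simp
  qed
  have inj: "inj_on (\<lambda>a. (f ^^ a) r) {..<L}"
    by (rule linorder_inj_onI) (use neq in auto)
  have "(\<lambda>a. (f ^^ a) r) ` {..<L} = A"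
  proof
    show "(\<lambda>a. (f ^^ a) r) ` {..<L} \<subseteq> A" using funpow_mem[OF fA r] by blast
    show "A \<subseteq> (\<lambda>a. (f ^^ a) r) ` {..<L}"
    proof
      fix t assume "t \<in> A"
      then obtain k where "(f ^^ k) r = t" using trans r by blast
      then have "(f ^^ (k mod L)) r = t" using modL by simp
      then show "t \<in> (\<lambda>a. (f ^^ a) r) ` {..<L}" using L(1) by auto
    qed
  qed
  then have "card A = L" using inj card_image by fastforce
  moreover have "(f ^^ a) r = (f ^^ b) r \<longleftrightarrow> a mod L = b mod L"
  proof
    assume "(f ^^ a) r = (f ^^ b) r"
    then have "(f ^^ (a mod L)) r = (f ^^ (b mod L)) r" using modL by metis
    then show "a mod L = b mod L"
      using inj L(1) by (auto dest!: inj_onD)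
  next
    assume "a mod L = b mod L"
    then show "(f ^^ a) r = (f ^^ b) r" using modL by metis
  qed
  ultimately show ?thesis by simp
qed

lemma inj_on_finite_periodic:
  assumes fin: "finite A" and fA: "f \<in> A \<rightarrow> A" and inj: "inj_on f A" and t: "t \<in> A"
  shows "\<exists>l>0. (f ^^ l) t = t"
proof -
  have "\<not> inj_on (\<lambda>k. (f ^^ k) t) (UNIV :: nat set)"
  proof
    assume "inj_on (\<lambda>k. (f ^^ k) t) (UNIV :: nat set)"
    moreover have "range (\<lambda>k. (f ^^ k) t) \<subseteq> A" using funpow_mem[OF fA t] by blast
    ultimately show False
      using fin finite_imageD finite_subset infinite_UNIV_nat by blast
  qed
  then obtain i j :: nat where "i < j" "(f ^^ i) t = (f ^^ j) t"
    by (metis linorder_inj_onI')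
  then have "(f ^^ i) t = (f ^^ i) ((f ^^ (j - i)) t)"
    by (metis funpow_add le_add_diff_inverse less_imp_le o_apply)
  then have "t = (f ^^ (j - i)) t"
    using funpow_cancel[OF inj fA t] funpow_mem[OF fA t] by metis
  then show ?thesis using \<open>i < j\<close> by (metis zero_less_diff)
qed


section \<open>Residues of points of the odometer space\<close>

locale odometer_base =
  fixes \<alpha> :: "nat \<Rightarrow> nat"
  assumes alpha: "\<And>i. 2 \<le> \<alpha> i"
begin

abbreviation XX where "XX \<equiv> odometer_space \<alpha>"
abbreviation X where "X \<equiv> topspace (odometer_space \<alpha>)"
abbreviation T where "T \<equiv> odometer \<alpha>"

definition modulus :: "nat \<Rightarrow> nat" where "modulus n = (\<Prod>i<n. \<alpha> i)"

definition residue :: "nat \<Rightarrow> (nat \<Rightarrow> nat) \<Rightarrow> nat" where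
  "residue n x = (\<Sum>i<n. x i * modulus i)"

lemma alpha_pos: "0 < \<alpha> i"
  using alpha[of i] by simp

lemma modulus_pos: "0 < modulus n"
  unfolding modulus_def by (simp add: alpha_pos prod_pos)

lemma modulus_Suc: "modulus (Suc n) = \<alpha> n * modulus n"
  by (simp add: modulus_def)

lemma modulus_dvd: "m \<le> n \<Longrightarrow> modulus m dvd modulus n"
  unfolding modulus_def by (intro prod_dvd_prod_subset) auto

lemma modulus_gt: "n < modulus n"
proof (induction n)
  case (Suc n)
  have "2 * modulus n \<le> modulus (Suc n)" using alpha by (simp add: modulus_Suc)
  then show ?case using Suc by simp
qed (simp add: modulus_def)

lemma mem_X_iff: "x \<in> X \<longleftrightarrow> (\<forall>i. x i < \<alpha> i)"
  by (auto simp: odometer_space_def PiE_iff)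

lemma zero_mem_X: "(\<lambda>_. 0) \<in> X"
  by (simp add: mem_X_iff alpha_pos)

lemma residue_Suc: "residue (Suc n) x = residue n x + x n * modulus n"
  by (simp add: residue_def)

lemma residue_less: "x \<in> X \<Longrightarrow> residue n x < modulus n"
proof (induction n)
  case 0 show ?case by (simp add: residue_def modulus_def)
next
  case (Suc n)
  have "residue n x + x n * modulus n < Suc (x n) * modulus n" using Suc by simp
  also have "\<dots> \<le> \<alpha> n * modulus n"
    using Suc.prems by (intro mult_right_mono) (auto simp: mem_X_iff Suc_le_eq)
  finally show ?case by (simp add: residue_Suc modulus_Suc)
qed

lemma residue_eq_iff:
  assumes "x \<in> X" "y \<in> X"
  shows "residue n x = residue n y \<longleftrightarrow> (\<forall>i<n. x i = y i)"
proof (induction n)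
  case 0 show ?case by (simp add: residue_def)
next
  case (Suc n)
  have "residue (Suc n) x = residue (Suc n) y \<longleftrightarrow> residue n x = residue n y \<and> x n = y n"
  proof
    assume eq: "residue (Suc n) x = residue (Suc n) y"
    have dm: "residue (Suc n) w mod modulus n = residue n w \<and> residue (Suc n) w div modulus n = w n"
      if "w \<in> X" for w
      using residue_less[OF that, of n] modulus_pos[of n] by (simp add: residue_Suc)
    show "residue n x = residue n y \<and> x n = y n"
      using dm[OF assms(1)] dm[OF assms(2)] eq by simp
  qed (simp add: residue_Suc)
  then show ?case using Suc by (auto simp: less_Suc_eq)
qed

lemma residue_eq_mono:
  assumes "x \<in> X" "y \<in> X" "residue n x = residue n y" "m \<le> n"
  shows "residue m x = residue m y"
  using assms by (simp add: residue_eq_iff)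

lemma residue_ext:
  assumes "x \<in> X" "y \<in> X" "\<And>n. N \<le> n \<Longrightarrow> residue n x = residue n y"
  shows "x = y"
proof
  fix i
  have "residue (N + Suc i) x = residue (N + Suc i) y" using assms by simp
  then show "x i = y i" using assms(1,2) by (simp add: residue_eq_iff)
qed

lemma openin_cylinder:
  assumes "y \<in> X" shows "openin XX {x \<in> X. residue n x = residue n y}"
proof -
  have "{x \<in> X. residue n x = residue n y} = PiE UNIV (\<lambda>i. if i < n then {y i} else {..<\<alpha> i})"
    (is "?L = ?R")
  proof (rule set_eqI)
    fix x
    have "x \<in> ?R \<longleftrightarrow> x \<in> X \<and> (\<forall>i<n. x i = y i)"
      using assms by (auto simp: PiE_iff mem_X_iff split: if_splits)
    then show "x \<in> ?L \<longleftrightarrow> x \<in> ?R" using residue_eq_iff[OF _ assms] by blast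
  qed
  moreover have "openin XX \<dots>"
    unfolding odometer_space_def
  proof (rule product_topology_basis)
    show "openin (discrete_topology {..<\<alpha> i}) (if i < n then {y i} else {..<\<alpha> i})" for i
      using assms by (auto simp: mem_X_iff)
    have "{i. (if i < n then {y i} else {..<\<alpha> i}) \<noteq> topspace (discrete_topology {..<\<alpha> i})} \<subseteq> {..<n}"
      by auto
    then show "finite {i. (if i < n then {y i} else {..<\<alpha> i}) \<noteq> topspace (discrete_topology {..<\<alpha> i})}"
      using finite_subset by blast
  qed
  ultimately show ?thesis by simp
qed

text \<open>
  A basic open set of the product restricts finitely many coordinates, all of them below some \<open>n\<close>.
\<close>
lemma open_contains_cylinder:
  assumes U: "openin XX U" and y: "y \<in> U"
  shows "\<exists>n. {x \<in> X. residue n x = residue n y} \<subseteq> U"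
proof -
  obtain V where fin: "finite {i. V i \<noteq> {..<\<alpha> i}}" and yV: "y \<in> PiE UNIV V" and VU: "PiE UNIV V \<subseteq> U"
    using bspec[OF U[unfolded odometer_space_def openin_product_topology_alt] y] by auto
  obtain n where n: "\<And>i. V i \<noteq> {..<\<alpha> i} \<Longrightarrow> i < n"
    using fin finite_nat_set_iff_bounded by (metis (mono_tags, lifting) mem_Collect_eq)
  have yX: "y \<in> X" using U y openin_subset by blast
  have "x \<in> U" if x: "x \<in> X" "residue n x = residue n y" for x
  proof -
    have "x i \<in> V i" for i
    proof (cases "i < n")
      case True then show ?thesis using x yX yV by (auto simp: residue_eq_iff PiE_iff)
    next
      case False then show ?thesis using n x by (auto simp: mem_X_iff)
    qed
    then show ?thesis using VU by (auto simp: PiE_iff)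
  qed
  then show ?thesis by blast
qed

lemma continuous_map_of_residue:
  assumes FY: "F \<in> X \<rightarrow> topspace Y"
    and F: "\<And>x y. x \<in> X \<Longrightarrow> y \<in> X \<Longrightarrow> residue n x = residue n y \<Longrightarrow> F x = F y"
  shows "continuous_map XX Y F"
  unfolding continuous_map_def
proof (intro conjI allI impI FY)
  fix U assume "openin Y U"
  show "openin XX {x \<in> X. F x \<in> U}"
  proof (subst openin_subopen, clarify)
    fix y assume y: "y \<in> X" "F y \<in> U"
    then have "F x \<in> U" if "x \<in> X" "residue n x = residue n y" for x
      using F[OF that(1) y(1) that(2)] by simp
    then have "{x \<in> X. residue n x = residue n y} \<subseteq> {x \<in> X. F x \<in> U}" by blast
    then show "\<exists>V. openin XX V \<and> y \<in> V \<and> V \<subseteq> {x \<in> X. F x \<in> U}"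
      using openin_cylinder[OF y(1)] y(1) by blast
  qed
qed

text \<open>
  The number of digits that must be read may grow with the coordinate \<open>i\<close> of the value.
\<close>
lemma continuous_map_of_coordinates:
  assumes FX: "F \<in> X \<rightarrow> X"
    and F: "\<And>i. \<exists>n. \<forall>x\<in>X. \<forall>y\<in>X. residue n x = residue n y \<longrightarrow> F x i = F y i"
  shows "continuous_map XX XX F"
proof -
  have "continuous_map XX (discrete_topology {..<\<alpha> i}) (\<lambda>x. F x i)" for i
  proof -
    obtain n where n: "\<forall>x\<in>X. \<forall>y\<in>X. residue n x = residue n y \<longrightarrow> F x i = F y i"
      using F by blast
    have "F x i < \<alpha> i" if "x \<in> X" for x
      using funcset_mem[OF FX that] by (simp add: mem_X_iff)
    then have "(\<lambda>x. F x i) \<in> X \<rightarrow> topspace (discrete_topology {..<\<alpha> i})" by simp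
    then show ?thesis
      by (rule continuous_map_of_residue[of _ _ n]) (use n in blast)
  qed
  then show ?thesis
    by (simp add: odometer_space_def continuous_map_componentwise_UNIV)
qed

lemma compact_XX: "compact_space XX"
  by (simp add: odometer_space_def compact_space_product_topology compact_space_discrete_topology)

lemma Hausdorff_XX: "Hausdorff_space XX"
  by (simp add: odometer_space_def Hausdorff_space_product_topology)


section \<open>The odometer adds one to every residue\<close>

lemma T_mem: "x \<in> X \<Longrightarrow> T x \<in> X"
  by (simp add: mem_X_iff odometer_def adic_add_def alpha_pos)

lemma T_Pi: "T \<in> X \<rightarrow> X"
  using T_mem by blast

lemmas T_pow_mem = funpow_mem[OF T_Pi]

text \<open>
  The carries telescope.  Regarding the added \<open>1\<close> as a carry into position \<open>0\<close>, each digit satisfies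
  new digit + base * carry out = old digit + carry in; weighting with the moduli and summing leaves
  only the carry out of position \<open>n\<close>, which is a multiple of the \<open>n\<close>th modulus.
\<close>
lemma residue_T:
  assumes x: "x \<in> X"
  shows "residue n (T x) = Suc (residue n x) mod modulus n"
proof -
  let ?e = "\<lambda>i::nat. if i = 0 then 1 else 0 :: nat"
  let ?c = "carry \<alpha> x ?e"
  have c1: "?c j \<le> 1" for j by (cases j) auto
  have digit: "T x j + \<alpha> j * ?c (Suc j) = x j + ?e j + ?c j" for j
  proof -
    have "x j < \<alpha> j" using x by (simp add: mem_X_iff)
    moreover have "?e j + ?c j \<le> 1" using c1[of j] by auto
    \<comment> \<open>A single carry arrives, so a digit overflows at most to its base itself.\<close>
    ultimately have s: "x j + ?e j + ?c j \<le> \<alpha> j" by linarith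
    have pos: "0 < \<alpha> j" using \<open>x j < \<alpha> j\<close> by simp
    show ?thesis
    proof (cases "x j + ?e j + ?c j < \<alpha> j")
      case True
      then show ?thesis by (simp add: odometer_def adic_add_def)
    next
      case False
      then have "x j + ?e j + ?c j = \<alpha> j" using s by simp
      then show ?thesis by (simp add: odometer_def adic_add_def)
    qed
  qed
  have "residue n (T x) + modulus n * (?c n + ?e n) = residue n x + 1"
  proof (induction n)
    case 0 show ?case by (simp add: residue_def modulus_def)
  next
    case (Suc n)
    have "residue (Suc n) (T x) + modulus (Suc n) * (?c (Suc n) + ?e (Suc n))
        = residue n (T x) + modulus n * (T x n + \<alpha> n * ?c (Suc n))"
      by (simp add: residue_Suc modulus_Suc algebra_simps)
    also have "\<dots> = residue n (T x) + modulus n * (?c n + ?e n) + modulus n * x n"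
      by (simp only: digit) (simp add: algebra_simps)
    also have "\<dots> = residue (Suc n) x + 1"
      using Suc by (simp add: residue_Suc)
    finally show ?case .
  qed
  then have "Suc (residue n x) mod modulus n
      = (residue n (T x) + modulus n * (?c n + ?e n)) mod modulus n" by simp
  also have "\<dots> = residue n (T x)"
    using residue_less[OF T_mem[OF x]] by simp
  finally show ?thesis ..
qed

lemma residue_T_pow:
  assumes "x \<in> X" shows "residue n ((T ^^ k) x) = (residue n x + k) mod modulus n"
proof (induction k)
  case 0 show ?case using residue_less[OF assms] by simp
next
  case (Suc k)
  then show ?case using residue_T T_pow_mem[OF assms] by (simp add: mod_Suc_eq)
qed

text \<open>
  The moduli are unbounded, so two different numbers of steps are told apart at a high level.
\<close>
lemma T_pow_eqD:
  assumes "x \<in> X" "(T ^^ a) x = (T ^^ b) x" shows "a = b"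
proof -
  let ?n = "max a b"
  have "(residue ?n x + a) mod modulus ?n = (residue ?n x + b) mod modulus ?n"
    using residue_T_pow[OF assms(1)] assms(2) by metis
  then have "a mod modulus ?n = b mod modulus ?n"
    by (simp add: nat_mod_eq_iff)
  moreover have "?n < modulus ?n" by (rule modulus_gt)
  ultimately show ?thesis by simp
qed

lemma T_continuous: "continuous_map XX XX T"
proof (rule continuous_map_of_coordinates[OF T_Pi])
  fix i
  have "T x i = T y i" if "x \<in> X" "y \<in> X" "residue (Suc i) x = residue (Suc i) y" for x y
  proof -
    have "residue (Suc i) (T x) = residue (Suc i) (T y)" using that residue_T by simp
    then show ?thesis using that T_mem by (simp add: residue_eq_iff)
  qed
  then show "\<exists>n. \<forall>x\<in>X. \<forall>y\<in>X. residue n x = residue n y \<longrightarrow> T x i = T y i" by blast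
qed

lemma T_inj: "inj_on T X"
proof
  fix x y assume xy: "x \<in> X" "y \<in> X" "T x = T y"
  show "x = y"
  proof (rule residue_ext[OF xy(1,2), of 0])
    fix n
    have "(residue n x + 1) mod modulus n = (residue n y + 1) mod modulus n"
      using residue_T[OF xy(1)] residue_T[OF xy(2)] xy(3) by simp
    then have "residue n x mod modulus n = residue n y mod modulus n"
      by (simp add: nat_mod_eq_iff)
    then show "residue n x = residue n y" using residue_less xy by simp
  qed
qed

text \<open>
  Up to level \<open>n\<close>, going back one step is the same as going forward \<open>modulus n - 1\<close> steps.  These
  approximate preimages of \<open>w\<close> agree on their common digits and so define a preimage.
\<close>
lemma T_bij: "bij_betw T X X"
proof -
  have "w \<in> T ` X" if w: "w \<in> X" for w
  proof -
    define y where "y = (\<lambda>i. (T ^^ (modulus (Suc i) - 1)) w i)"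
    have yX: "y \<in> X" using T_pow_mem[OF w] by (auto simp: y_def mem_X_iff)
    have res: "residue n y = residue n ((T ^^ (modulus n - 1)) w)" for n
    proof -
      have "y i = (T ^^ (modulus n - 1)) w i" if i: "i < n" for i
      proof -
        obtain k where k: "modulus n = modulus (Suc i) * k"
          using modulus_dvd[of "Suc i" n] i by auto
        have k0: "0 < k" using k modulus_pos[of n] by (cases k) auto
        have "modulus n - 1 = modulus (Suc i) - 1 + modulus (Suc i) * (k - 1)"
          using k k0 modulus_pos[of "Suc i"] by (cases k) (auto simp: algebra_simps)
        then have "residue (Suc i) w + (modulus n - 1)
           = residue (Suc i) w + (modulus (Suc i) - 1) + modulus (Suc i) * (k - 1)" by simp
        then have "residue (Suc i) ((T ^^ (modulus (Suc i) - 1)) w)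
              = residue (Suc i) ((T ^^ (modulus n - 1)) w)"
          by (simp only: residue_T_pow[OF w] mod_mult_self2)
        then show ?thesis
          unfolding y_def using T_pow_mem[OF w] by (simp add: residue_eq_iff)
      qed
      then show ?thesis using yX T_pow_mem[OF w] by (simp add: residue_eq_iff)
    qed
    have "T y = w"
    proof (rule residue_ext[OF T_mem[OF yX] w, of 0])
      fix n
      have "residue n (T y) = Suc ((residue n w + (modulus n - 1)) mod modulus n) mod modulus n"
        by (simp add: residue_T[OF yX] res residue_T_pow[OF w])
      also have "\<dots> = (residue n w + modulus n) mod modulus n"
        using modulus_pos[of n] by (simp add: mod_Suc_eq)
      finally show "residue n (T y) = residue n w" using residue_less[OF w] by simp
    qed
    then show ?thesis using yX by blast
  qed
  then show ?thesis using T_inj T_mem by (auto simp: bij_betw_def)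
qed


section \<open>Maps that cycle through all residues\<close>

text \<open>
  At level \<open>n\<close> the map descends to the residues and acts on them as one cycle through all of them.
\<close>
definition cyclic_at :: "nat \<Rightarrow> ((nat \<Rightarrow> nat) \<Rightarrow> nat \<Rightarrow> nat) \<Rightarrow> bool" where
  "cyclic_at n F \<longleftrightarrow> F \<in> X \<rightarrow> X \<and>
     (\<forall>x\<in>X. \<forall>y\<in>X. residue n x = residue n y \<longrightarrow> residue n (F x) = residue n (F y)) \<and>
     (\<forall>x\<in>X. \<forall>y\<in>X. \<exists>k. residue n ((F ^^ k) x) = residue n y)"

lemma
  assumes "cyclic_at n F"
  shows cyclic_Pi: "F \<in> X \<rightarrow> X"
    and cyclic_cong: "\<And>x y. x \<in> X \<Longrightarrow> y \<in> X \<Longrightarrow> residue n x = residue n y \<Longrightarrow>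
      residue n (F x) = residue n (F y)"
    and cyclic_reaches: "\<And>x y. x \<in> X \<Longrightarrow> y \<in> X \<Longrightarrow> \<exists>k. residue n ((F ^^ k) x) = residue n y"
  using assms unfolding cyclic_at_def by blast+

lemma residue_onto: "r < modulus n \<Longrightarrow> residue n ((T ^^ r) (\<lambda>_. 0)) = r"
  using residue_T_pow[OF zero_mem_X, of n r] by (simp add: residue_def)

lemma residue_image: "residue n ` X = {..<modulus n}"
proof
  show "{..<modulus n} \<subseteq> residue n ` X"
  proof
    fix r assume "r \<in> {..<modulus n}"
    then have "r = residue n ((T ^^ r) (\<lambda>_. 0))" using residue_onto by simp
    then show "r \<in> residue n ` X" using T_pow_mem[OF zero_mem_X] by blast
  qed
qed (use residue_less in auto)

text \<open>
  The action on residues, computed with an arbitrary representative; it is meaningful when \<open>F\<close>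
  respects the residue at level \<open>n\<close>.
\<close>
definition induced :: "nat \<Rightarrow> ((nat \<Rightarrow> nat) \<Rightarrow> nat \<Rightarrow> nat) \<Rightarrow> nat \<Rightarrow> nat" where
  "induced n F r = residue n (F (inv_into X (residue n) r))"

lemma residue_funpow:
  assumes FX: "F \<in> X \<rightarrow> X"
    and F: "\<And>x y. x \<in> X \<Longrightarrow> y \<in> X \<Longrightarrow> residue n x = residue n y \<Longrightarrow> residue n (F x) = residue n (F y)"
    and x: "x \<in> X"
  shows "residue n ((F ^^ k) x) = (induced n F ^^ k) (residue n x)"
proof (induction k)
  case (Suc k)
  have "residue n (F y) = induced n F (residue n y)" if "y \<in> X" for y
    unfolding induced_def using that
    by (intro F) (auto simp: f_inv_into_f inv_into_into)
  then show ?case using Suc funpow_mem[OF FX x] by simp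
qed simp

lemma induced_Pi:
  assumes FX: "F \<in> X \<rightarrow> X"
  shows "induced n F \<in> {..<modulus n} \<rightarrow> {..<modulus n}"
proof
  fix r assume "r \<in> {..<modulus n}"
  then have "inv_into X (residue n) r \<in> X"
    using inv_into_into[of r "residue n" X] residue_image by simp
  then show "induced n F r \<in> {..<modulus n}"
    using residue_less funcset_mem[OF FX] by (simp add: induced_def)
qed

lemma cyclic_funpow_cong:
  assumes "cyclic_at n F" "x \<in> X" "y \<in> X" "residue n x = residue n y"
  shows "residue n ((F ^^ k) x) = residue n ((F ^^ k) y)"
proof -
  have "residue n ((F ^^ k) u) = (induced n F ^^ k) (residue n u)" if "u \<in> X" for u
    by (rule residue_funpow[OF cyclic_Pi[OF assms(1)] cyclic_cong[OF assms(1)] that])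
  then show ?thesis using assms(2-4) by simp
qed

lemma cyclic_funpow_eq_iff:
  assumes c: "cyclic_at n F" and x: "x \<in> X"
  shows "residue n ((F ^^ a) x) = residue n ((F ^^ b) x) \<longleftrightarrow> a mod modulus n = b mod modulus n"
proof -
  have FX: "F \<in> X \<rightarrow> X" by (rule cyclic_Pi[OF c])
  have res: "residue n ((F ^^ k) y) = (induced n F ^^ k) (residue n y)" if "y \<in> X" for k y
    using residue_funpow[OF FX cyclic_cong[OF c] that] .
  have "\<exists>k. (induced n F ^^ k) s = t" if s: "s \<in> {..<modulus n}" and t: "t \<in> {..<modulus n}" for s t
  proof -
    obtain u v where "u \<in> X" "v \<in> X" "s = residue n u" "t = residue n v"
      using s t residue_image by (metis imageE)
    then show ?thesis using cyclic_reaches[OF c] res by metis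
  qed
  then have "(induced n F ^^ a) (residue n x) = (induced n F ^^ b) (residue n x)
      \<longleftrightarrow> a mod card {..<modulus n} = b mod card {..<modulus n}"
    using residue_less[OF x] induced_Pi[OF FX] by (intro transitive_funpow_eq_iff) auto
  then show ?thesis using res x by simp
qed

lemma T_cyclic: "cyclic_at n T"
proof -
  have "\<exists>k. residue n ((T ^^ k) x) = residue n y" if "x \<in> X" "y \<in> X" for x y
  proof -
    have "residue n ((T ^^ (modulus n - residue n x + residue n y)) x) = residue n y"
      using residue_less[OF that(1), of n] residue_less[OF that(2), of n]
      by (simp add: residue_T_pow[OF that(1)])
    then show ?thesis by blast
  qed
  then show ?thesis using T_Pi residue_T unfolding cyclic_at_def by simp
qed

text \<open>
  Up to level \<open>n\<close>, a point \<open>x\<close> is an iterate \<open>F\<^sup>a z\<close> with \<open>a\<close> unique modulo \<open>modulus n\<close>; send it to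
  \<open>G\<^sup>a z\<close>.  Since \<open>G\<close> has the same period at each level, the choice of \<open>a\<close> does not matter and the
  prescriptions at different levels are compatible.
\<close>
lemma cyclic_transfer:
  assumes F: "\<And>n. N \<le> n \<Longrightarrow> cyclic_at n F" and G: "\<And>n. N \<le> n \<Longrightarrow> cyclic_at n G" and z: "z \<in> X"
  obtains h where "continuous_map XX XX h"
    and "\<And>x n a. x \<in> X \<Longrightarrow> N \<le> n \<Longrightarrow> residue n x = residue n ((F ^^ a) z) \<Longrightarrow>
      residue n (h x) = residue n ((G ^^ a) z)"
proof -
  define K where "K n x = (SOME k. residue n ((F ^^ k) z) = residue n x)" for n x
  \<comment> \<open>Digit \<open>i\<close> of the image needs level \<open>Suc i\<close>; adding \<open>N\<close> makes the level admissible.\<close>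
  define h where "h x = (\<lambda>i. (G ^^ K (N + Suc i) x) z i)" for x
  have FX: "F \<in> X \<rightarrow> X" and GX: "G \<in> X \<rightarrow> X" using cyclic_Pi[OF F] cyclic_Pi[OF G] by blast+
  note Fz = funpow_mem[OF FX z] and Gz = funpow_mem[OF GX z]
  have K: "residue n ((F ^^ K n x) z) = residue n x" if "x \<in> X" "N \<le> n" for n x
    unfolding K_def using cyclic_reaches[OF F[OF that(2)] z that(1)] by (rule someI_ex)
  have hX: "h \<in> X \<rightarrow> X" using Gz by (auto simp: h_def mem_X_iff)
  show ?thesis
  proof
    show "continuous_map XX XX h"
    proof (rule continuous_map_of_coordinates[OF hX])
      fix i
      have "\<forall>x\<in>X. \<forall>y\<in>X. residue (N + Suc i) x = residue (N + Suc i) y \<longrightarrow> h x i = h y i"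
        by (simp add: h_def K_def)
      then show "\<exists>n. \<forall>x\<in>X. \<forall>y\<in>X. residue n x = residue n y \<longrightarrow> h x i = h y i" by blast
    qed
  next
    fix x n a assume x: "x \<in> X" and n: "N \<le> n" and a: "residue n x = residue n ((F ^^ a) z)"
    have "h x i = (G ^^ a) z i" if i: "i < n" for i
    proof -
      define m where "m = min n (N + Suc i)"
      have m: "N \<le> m" "m \<le> n" "m \<le> N + Suc i" "i < m" using n i by (auto simp: m_def)
      have "residue m ((F ^^ K (N + Suc i) x) z) = residue m x"
        using residue_eq_mono[OF Fz x K[OF x] m(3)] by simp
      also have "\<dots> = residue m ((F ^^ a) z)"
        using residue_eq_mono[OF x Fz a m(2)] .
      finally have "K (N + Suc i) x mod modulus m = a mod modulus m"
        using cyclic_funpow_eq_iff[OF F[OF m(1)] z] by simp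
      then have "residue m ((G ^^ K (N + Suc i) x) z) = residue m ((G ^^ a) z)"
        using cyclic_funpow_eq_iff[OF G[OF m(1)] z] by simp
      then show ?thesis
        unfolding h_def using m(4) Gz by (simp add: residue_eq_iff)
    qed
    then show "residue n (h x) = residue n ((G ^^ a) z)"
      using hX x Gz by (subst residue_eq_iff) auto
  qed
qed

text \<open>
  The transfer maps from \<open>F\<close> to \<open>G\<close> and from \<open>G\<close> to \<open>F\<close> undo each other at each level, and one step
  of \<open>F\<close> becomes one step of \<open>G\<close> because both raise the number \<open>a\<close> of steps by one.
\<close>
lemma cyclic_conjugate:
  assumes F: "\<And>n. N \<le> n \<Longrightarrow> cyclic_at n F" and G: "\<And>n. N \<le> n \<Longrightarrow> cyclic_at n G"
  shows "topologically_conjugate XX F XX G"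
proof -
  let ?z = "\<lambda>_. 0 :: nat"
  note z = zero_mem_X
  have FX: "F \<in> X \<rightarrow> X" and GX: "G \<in> X \<rightarrow> X" using cyclic_Pi[OF F] cyclic_Pi[OF G] by blast+
  note Fz = funpow_mem[OF FX z] and Gz = funpow_mem[OF GX z]
  obtain h where h: "continuous_map XX XX h"
    and hr: "\<And>x n a. x \<in> X \<Longrightarrow> N \<le> n \<Longrightarrow> residue n x = residue n ((F ^^ a) ?z) \<Longrightarrow>
      residue n (h x) = residue n ((G ^^ a) ?z)"
    using cyclic_transfer[OF F G z] by blast
  obtain g where g: "continuous_map XX XX g"
    and gr: "\<And>x n a. x \<in> X \<Longrightarrow> N \<le> n \<Longrightarrow> residue n x = residue n ((G ^^ a) ?z) \<Longrightarrow>
      residue n (g x) = residue n ((F ^^ a) ?z)"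
    using cyclic_transfer[OF G F z] by blast
  have hX: "h x \<in> X" and gX: "g x \<in> X" if "x \<in> X" for x
    using h g that by (auto simp: continuous_map_def)
  have Fex: "\<exists>a. residue n x = residue n ((F ^^ a) ?z)" if "x \<in> X" "N \<le> n" for x n
    using cyclic_reaches[OF F[OF that(2)] z that(1)] by metis
  have Gex: "\<exists>a. residue n x = residue n ((G ^^ a) ?z)" if "x \<in> X" "N \<le> n" for x n
    using cyclic_reaches[OF G[OF that(2)] z that(1)] by metis
  have gh: "g (h x) = x" if x: "x \<in> X" for x
  proof (rule residue_ext[OF gX[OF hX[OF x]] x])
    fix n assume n: "N \<le> n"
    then obtain a where "residue n x = residue n ((F ^^ a) ?z)" using Fex x by blast
    then show "residue n (g (h x)) = residue n x" using gr hr hX x n by metis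
  qed
  have hg: "h (g x) = x" if x: "x \<in> X" for x
  proof (rule residue_ext[OF hX[OF gX[OF x]] x])
    fix n assume n: "N \<le> n"
    then obtain a where "residue n x = residue n ((G ^^ a) ?z)" using Gex x by blast
    then show "residue n (h (g x)) = residue n x" using gr hr gX x n by metis
  qed
  have "homeomorphic_maps XX XX h g"
    using h g gh hg by (simp add: homeomorphic_maps_def)
  then have "homeomorphic_map XX XX h"
    unfolding homeomorphic_map_maps by blast
  moreover have "h (F x) = G (h x)" if x: "x \<in> X" for x
  proof -
    have FxX: "F x \<in> X" and GhX: "G (h x) \<in> X" using FX GX x hX by auto
    show ?thesis
    proof (rule residue_ext[OF hX[OF FxX] GhX])
      fix n assume n: "N \<le> n"
      obtain a where a: "residue n x = residue n ((F ^^ a) ?z)" using Fex x n by blast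
      then have "residue n (F x) = residue n ((F ^^ Suc a) ?z)"
        using cyclic_funpow_cong[OF F[OF n] x Fz a, of 1] by simp
      then have "residue n (h (F x)) = residue n ((G ^^ Suc a) ?z)"
        using hr FxX n by blast
      also have "\<dots> = residue n (G (h x))"
        using cyclic_funpow_cong[OF G[OF n] hX[OF x] Gz hr[OF x n a], of 1] by simp
      finally show "residue n (h (F x)) = residue n (G (h x))" .
    qed
  qed
  ultimately show ?thesis unfolding topologically_conjugate_def by blast
qed

end


section \<open>Bounded speedups\<close>

locale speedup = odometer_base +
  fixes p :: "(nat \<Rightarrow> nat) \<Rightarrow> nat" and S :: "(nat \<Rightarrow> nat) \<Rightarrow> nat \<Rightarrow> nat"
  assumes p_pos: "\<And>x. x \<in> X \<Longrightarrow> 0 < p x"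
    and p_bounded: "bdd_above (p ` X)"
    and S_eq: "\<And>x. x \<in> X \<Longrightarrow> S x = (T ^^ p x) x"
    and S_homeo: "homeomorphic_map XX XX S"
    and S_minimal: "minimal_homeomorphism XX S"
begin

lemma S_bij: "bij_betw S X X"
  using S_homeo homeomorphic_imp_surjective_map homeomorphic_imp_injective_map
  unfolding bij_betw_def by blast

lemma S_Pi: "S \<in> X \<rightarrow> X"
  using S_bij bij_betw_imp_funcset by blast

lemmas S_pow_mem = funpow_mem[OF S_Pi]

lemma S_pow_cancel: "x \<in> X \<Longrightarrow> y \<in> X \<Longrightarrow> (S ^^ k) x = (S ^^ k) y \<Longrightarrow> x = y"
  using funpow_cancel[of S X] S_bij S_Pi by (auto simp: bij_betw_def)

lemma T_pow_continuous: "continuous_map XX XX (T ^^ k)"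
proof (induction k)
  case (Suc k)
  show ?case using continuous_map_compose[OF Suc T_continuous] by (simp add: comp_def)
qed (simp add: id_def)

text \<open>
  As \<open>T\<close> has no periodic points, each level set of \<open>p\<close> is the closed set where \<open>S\<close> coincides with a
  power of \<open>T\<close>; by boundedness its complement is a finite union of such sets.
\<close>
lemma jump_level_open: "openin XX {x \<in> X. p x = k}"
proof -
  have closed: "closedin XX {x \<in> X. p x = k}" for k
  proof -
    have "p x = k \<longleftrightarrow> S x = (T ^^ k) x" if "x \<in> X" for x
      using S_eq[OF that] T_pow_eqD[OF that] by auto
    then have "{x \<in> X. p x = k} = {x \<in> X. S x = (T ^^ k) x}" by blast
    then show ?thesis
      using closedin_continuous_maps_eq[OF Hausdorff_XX
          homeomorphic_imp_continuous_map[OF S_homeo] T_pow_continuous] by simp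
  qed
  obtain B where B: "\<And>x. x \<in> X \<Longrightarrow> p x \<le> B"
    using p_bounded unfolding bdd_above_def by blast
  have "closedin XX (\<Union>j\<in>{..B} - {k}. {x \<in> X. p x = j})"
    by (rule closedin_Union) (use closed in auto)
  moreover have "{x \<in> X. p x = k} = X - (\<Union>j\<in>{..B} - {k}. {x \<in> X. p x = j})"
    using B by auto
  ultimately show ?thesis by (simp add: openin_diff)
qed

text \<open>
  By compactness finitely many cylinders on which \<open>p\<close> is constant cover the space, and the
  deepest of them gives the level.
\<close>
lemma jump_level:
  obtains N where "\<And>x y. x \<in> X \<Longrightarrow> y \<in> X \<Longrightarrow> residue N x = residue N y \<Longrightarrow> p x = p y"
proof -
  define cyl where "cyl n x = {y \<in> X. residue n y = residue n x}" for n x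
  have "\<exists>n. cyl n x \<subseteq> {y \<in> X. p y = p x}" if "x \<in> X" for x
    unfolding cyl_def using open_contains_cylinder[OF jump_level_open, of x "p x"] that by blast
  then obtain n where n: "\<And>x. x \<in> X \<Longrightarrow> cyl (n x) x \<subseteq> {y \<in> X. p y = p x}" by metis
  have cover: "X \<subseteq> (\<Union>x\<in>X. cyl (n x) x)" by (auto simp: cyl_def)
  have "openin XX U" if "U \<in> (\<lambda>x. cyl (n x) x) ` X" for U
    using that openin_cylinder by (auto simp: cyl_def)
  then obtain \<F> where \<F>: "finite \<F>" "\<F> \<subseteq> (\<lambda>x. cyl (n x) x) ` X" "X \<subseteq> \<Union>\<F>"
    using compact_XX cover unfolding compact_space_alt by meson
  obtain F where F: "finite F" "F \<subseteq> X" "\<F> = (\<lambda>x. cyl (n x) x) ` F"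
    using finite_subset_image[OF \<F>(1,2)] by blast
  obtain N where N: "\<And>u. u \<in> F \<Longrightarrow> n u \<le> N"
    using F(1) finite_nat_set_iff_bounded_le[of "n ` F"] by auto
  show thesis
  proof
    fix x y assume xy: "x \<in> X" "y \<in> X" "residue N x = residue N y"
    obtain u where u: "u \<in> F" "x \<in> cyl (n u) u" using \<F>(3) F(3) xy(1) by blast
    then have "residue (n u) y = residue (n u) x"
      using residue_eq_mono[OF xy N[OF u(1)]] by simp
    then have "y \<in> cyl (n u) u" using u xy by (simp add: cyl_def)
    then have "p y = p u" "p x = p u" using n[of u] u F(2) by blast+
    then show "p x = p y" by simp
  qed
qed

lemma residue_S: "x \<in> X \<Longrightarrow> residue n (S x) = (residue n x + p x) mod modulus n"
  by (simp add: S_eq residue_T_pow)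

text \<open>
  \<open>S\<close> induces a surjection, hence a permutation, of the residues.  Minimality puts a point of the
  two-sided orbit of \<open>x\<close> into every cylinder; as every residue is periodic under the permutation, a
  nonnegative number of steps reaches that cylinder as well.
\<close>
lemma S_cyclic:
  assumes p: "\<And>x y. x \<in> X \<Longrightarrow> y \<in> X \<Longrightarrow> residue n x = residue n y \<Longrightarrow> p x = p y"
  shows "cyclic_at n S"
proof -
  let ?s = "induced n S" and ?A = "{..<modulus n}"
  have cong: "residue n (S x) = residue n (S y)"
    if "x \<in> X" "y \<in> X" "residue n x = residue n y" for x y
    using that p[OF that] by (simp add: residue_S)
  have res: "residue n ((S ^^ k) x) = (?s ^^ k) (residue n x)" if "x \<in> X" for x k
    by (rule residue_funpow[OF S_Pi cong that])
  have sA: "?s \<in> ?A \<rightarrow> ?A" by (rule induced_Pi[OF S_Pi])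
  have "?A \<subseteq> ?s ` ?A"
  proof
    fix r assume "r \<in> ?A"
    then obtain u where u: "u \<in> X" "r = residue n u" using residue_image by (metis imageE)
    then obtain v where v: "v \<in> X" "u = S v" using S_bij by (metis bij_betw_def imageE)
    then have "r = ?s (residue n v)" using res[OF v(1), of 1] u by simp
    then show "r \<in> ?s ` ?A" using residue_less[OF v(1)] by blast
  qed
  then have inj: "inj_on ?s ?A" by (intro finite_surj_inj) auto
  have "\<exists>k. residue n ((S ^^ k) x) = residue n y" if x: "x \<in> X" and y: "y \<in> X" for x y
  proof -
    have "y \<in> XX closure_of orbit XX S x"
      using S_minimal x y unfolding minimal_homeomorphism_def by blast
    then have "\<exists>w\<in>orbit XX S x. w \<in> {w \<in> X. residue n w = residue n y}"
      using openin_cylinder[OF y, of n] y unfolding in_closure_of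
      by (metis (mono_tags, lifting) mem_Collect_eq)
    then obtain w where w: "w \<in> orbit XX S x" "w \<in> X" "residue n w = residue n y"
      by blast
    then obtain a b where ab: "(S ^^ a) x = (S ^^ b) w"
      using mem_orbit_iff[OF S_bij x] by blast
    define t where "t = residue n y"
    have tA: "t \<in> ?A" using residue_less[OF y] by (simp add: t_def)
    obtain l where l: "0 < l" "(?s ^^ l) t = t"
      using inj_on_finite_periodic[OF _ sA inj tA] by blast
    have bl: "b \<le> b * l" using l(1) by simp
    have per: "(?s ^^ (b * l)) t = t" using funpow_mod_eq[OF l(2), of "b * l"] by simp
    \<comment> \<open>Going back \<open>b\<close> steps from the residue of \<open>S\<^sup>b w\<close> is going forward \<open>b * l - b\<close> steps.\<close>
    have "(?s ^^ (b * l - b + a)) (residue n x) = (?s ^^ (b * l - b)) ((?s ^^ b) t)"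
      using ab res[OF x, of a] res[OF w(2), of b] w(3) by (simp add: funpow_add t_def)
    also have "\<dots> = (?s ^^ (b * l - b + b)) t" by (simp only: funpow_add comp_apply)
    also have "\<dots> = t" using per bl by simp
    finally show ?thesis using res[OF x] unfolding t_def by metis
  qed
  then show ?thesis using S_Pi cong unfolding cyclic_at_def by blast
qed

section \<open>Displacement along a cycle and the coboundary equation\<close>

definition displacement :: "nat \<Rightarrow> (nat \<Rightarrow> nat) \<Rightarrow> nat" where
  "displacement k x = (\<Sum>j<k. p ((S ^^ j) x))"

lemma S_pow_eq: "x \<in> X \<Longrightarrow> (S ^^ k) x = (T ^^ displacement k x) x"
proof (induction k)
  case (Suc k)
  have "(S ^^ Suc k) x = (T ^^ p ((S ^^ k) x)) ((S ^^ k) x)"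
    using S_eq[OF S_pow_mem[OF Suc.prems]] by simp
  also have "\<dots> = (T ^^ (p ((S ^^ k) x) + displacement k x)) x"
    using Suc by (simp add: funpow_add)
  finally show ?case by (simp add: displacement_def add.commute)
qed (simp add: displacement_def)

lemma sum_over_cycle:
  fixes g :: "(nat \<Rightarrow> nat) \<Rightarrow> 'b::comm_monoid_add"
  assumes cyc: "cyclic_at n S" and x: "x \<in> X"
    and g: "\<And>x y. x \<in> X \<Longrightarrow> y \<in> X \<Longrightarrow> residue n x = residue n y \<Longrightarrow> g x = g y"
  shows "(\<Sum>j<modulus n. g ((S ^^ j) x)) = (\<Sum>r<modulus n. g (inv_into X (residue n) r))"
proof -
  let ?A = "{..<modulus n}"
  have inj: "inj_on (\<lambda>j. residue n ((S ^^ j) x)) ?A"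
    using cyclic_funpow_eq_iff[OF cyc x] by (auto simp: inj_on_def)
  have "(\<lambda>j. residue n ((S ^^ j) x)) ` ?A \<subseteq> ?A"
    using residue_less[OF S_pow_mem[OF x]] by blast
  then have bij: "bij_betw (\<lambda>j. residue n ((S ^^ j) x)) ?A ?A"
    using endo_inj_surj[OF _ _ inj] inj by (simp add: bij_betw_def)
  have "g ((S ^^ j) x) = g (inv_into X (residue n) (residue n ((S ^^ j) x)))" for j
    using S_pow_mem[OF x, of j] by (intro g) (auto simp: f_inv_into_f inv_into_into)
  then have "(\<Sum>j\<in>?A. g ((S ^^ j) x))
      = (\<Sum>j\<in>?A. g (inv_into X (residue n) (residue n ((S ^^ j) x))))" by simp
  also have "\<dots> = (\<Sum>r\<in>?A. g (inv_into X (residue n) r))"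
    by (rule sum.reindex_bij_betw[OF bij])
  finally show ?thesis .
qed

text \<open>
  Over one cycle every residue contributes its jump exactly once, so the displacement does not depend
  on the starting point; it is divisible by the modulus because the residue returns to its start.
\<close>
lemma displacement_period:
  assumes cyc: "cyclic_at n S"
    and p: "\<And>x y. x \<in> X \<Longrightarrow> y \<in> X \<Longrightarrow> residue n x = residue n y \<Longrightarrow> p x = p y"
  obtains c where "0 < c" "\<And>x. x \<in> X \<Longrightarrow> displacement (modulus n) x = c * modulus n"
proof -
  let ?z = "\<lambda>_. 0 :: nat"
  note z = zero_mem_X
  define M where "M = displacement (modulus n) ?z"
  have M: "displacement (modulus n) x = M" if "x \<in> X" for x
    unfolding M_def displacement_def
    using sum_over_cycle[where g = p, OF cyc that p] sum_over_cycle[where g = p, OF cyc z p] by metis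
  have "residue n ((S ^^ modulus n) ?z) = residue n ((S ^^ 0) ?z)"
    using cyclic_funpow_eq_iff[OF cyc z, of "modulus n" 0] by simp
  then have "(residue n ?z + M) mod modulus n = residue n ?z mod modulus n"
    using residue_T_pow[OF z, of n M] residue_T_pow[OF z, of n 0] S_pow_eq[OF z, of "modulus n"]
    by (simp add: M_def)
  then have "modulus n dvd M" by (simp add: residue_def mod_eq_0_iff_dvd)
  then obtain c where c: "M = c * modulus n" by (metis dvd_def mult.commute)
  have "0 < M"
    unfolding M_def displacement_def using modulus_pos p_pos[OF S_pow_mem[OF z]]
    by (intro sum_pos) (auto simp: lessThan_empty_iff)
  then have "0 < c" using c by (cases c) auto
  then show thesis using that c M by blast
qed

text \<open>
  With \<open>g\<^sub>k\<close> the sum of \<open>g\<close> over the first \<open>k\<close> points of the \<open>S\<close>-orbit, one has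
  \<open>g\<^sub>k - g\<^sub>k \<circ> S = g - g \<circ> S\<^sup>k\<close>.  Averaging over a full cycle of \<open>k\<close> removes the last term, so the
  average of the \<open>g\<^sub>k\<close> is a transfer function; it depends on the residue only, hence is continuous.
\<close>
lemma coboundary_of_zero_cycle_sum:
  fixes g :: "(nat \<Rightarrow> nat) \<Rightarrow> real"
  assumes cyc: "cyclic_at n S"
    and g: "\<And>x y. x \<in> X \<Longrightarrow> y \<in> X \<Longrightarrow> residue n x = residue n y \<Longrightarrow> g x = g y"
    and sum0: "\<And>x. x \<in> X \<Longrightarrow> (\<Sum>j<modulus n. g ((S ^^ j) x)) = 0"
  shows "coboundary XX S g"
proof -
  define Q where "Q = modulus n"
  define f where "f x = (\<Sum>k<Q. \<Sum>j<k. g ((S ^^ j) x)) / real Q" for x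
  have Q: "0 < Q" using modulus_pos by (simp add: Q_def)
  have gS: "g ((S ^^ j) x) = g ((S ^^ j) y)"
    if "x \<in> X" "y \<in> X" "residue n x = residue n y" for x y j
    using g[OF S_pow_mem[OF that(1)] S_pow_mem[OF that(2)] cyclic_funpow_cong[OF cyc that]] .
  have contg: "continuous_map XX euclideanreal g"
    by (rule continuous_map_of_residue[OF _ g]) simp
  have contf: "continuous_map XX euclideanreal f"
  proof (rule continuous_map_of_residue[of _ _ n])
    fix x y assume xy: "x \<in> X" "y \<in> X" "residue n x = residue n y"
    show "f x = f y" unfolding f_def by (simp only: gS[OF xy])
  qed simp
  have "g x = f x - f (S x)" if x: "x \<in> X" for x
  proof -
    have tele: "(\<Sum>j<k. g ((S ^^ j) x)) - (\<Sum>j<k. g ((S ^^ j) (S x))) = g x - g ((S ^^ k) x)" for k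
      by (induction k) (simp_all add: funpow_swap1)
    have "real Q * (f x - f (S x))
        = (\<Sum>k<Q. (\<Sum>j<k. g ((S ^^ j) x)) - (\<Sum>j<k. g ((S ^^ j) (S x))))"
      using Q by (simp add: f_def sum_subtractf diff_divide_distrib[symmetric])
    also have "\<dots> = real Q * g x"
      using sum0[OF x] by (simp add: tele sum_subtractf Q_def)
    finally show ?thesis using Q by simp
  qed
  then show ?thesis using contf contg unfolding coboundary_def by blast
qed

section \<open>The orbit number\<close>

text \<open>
  The hypotheses say \<open>S\<^sup>Q = T\<^bsup>c * Q\<^esup>\<close> with \<open>Q = modulus n\<close>.  Put \<open>b i = T\<^bsup>i * Q\<^esup> x\<close>; these are the points of
  the forward \<open>T\<close>-orbit with the residue of \<open>x\<close>, and \<open>S\<^sup>Q\<close> maps \<open>b i\<close> to \<open>b (i + c)\<close>.  As \<open>S\<close>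
  returns to a residue only after multiples of \<open>Q\<close> steps, \<open>b 0, \<dots>, b (c - 1)\<close> lie in different
  \<open>S\<close>-orbits.  Every point of the \<open>T\<close>-orbit is moved by iterates of \<open>S\<close> to the residue of \<open>x\<close>, and then
  differs from \<open>x\<close> by \<open>q * Q\<close> steps of \<open>T\<close>, so that reducing \<open>q\<close> modulo \<open>c\<close> connects it with one
  of these representatives.
\<close>
lemma orbit_number_of_period:
  assumes cyc: "cyclic_at n S" and c: "0 < c"
    and per: "\<And>x. x \<in> X \<Longrightarrow> displacement (modulus n) x = c * modulus n"
  shows "is_orbit_number XX T S c"
  unfolding is_orbit_number_def
proof (intro conjI ballI)
  show "0 < c" by fact
  fix x assume x: "x \<in> X"
  define Q where "Q = modulus n"
  have Q: "0 < Q" using modulus_pos by (simp add: Q_def)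
  have shift: "(S ^^ (k * Q)) y = (T ^^ (k * c * Q)) y" if y: "y \<in> X" for y k
  proof (induction k)
    case (Suc k)
    have "(S ^^ (Suc k * Q)) y = (S ^^ Q) ((S ^^ (k * Q)) y)" by (simp add: funpow_add)
    also have "\<dots> = (T ^^ (c * Q)) ((S ^^ (k * Q)) y)"
      using S_pow_eq[OF S_pow_mem[OF y], of Q] per[OF S_pow_mem[OF y]] by (simp add: Q_def)
    also have "\<dots> = (T ^^ (c * Q)) ((T ^^ (k * c * Q)) y)"
      by (simp only: Suc)
    finally show ?case by (simp add: funpow_add algebra_simps)
  qed simp
  define b where "b i = (T ^^ (i * Q)) x" for i
  have bX: "b i \<in> X" for i using T_pow_mem[OF x] by (simp add: b_def)
  have b_res: "residue n (b i) = residue n x" for i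
    using residue_less[OF x] by (simp add: b_def residue_T_pow[OF x] Q_def)
  have b_shift: "(S ^^ (k * Q)) (b i) = b (k * c + i)" for k i
    using shift[OF bX, of k i] by (simp add: b_def funpow_add distrib_right)
  have b_eqD: "i = j" if "b i = b j" for i j
    using T_pow_eqD[OF x, of "i * Q" "j * Q"] that Q by (simp add: b_def)
  have distinct: "i = j" if ij: "i < c" "j < c" and k: "(S ^^ k) (b i) = b j" for i j k
  proof -
    have "residue n ((S ^^ k) (b i)) = residue n ((S ^^ 0) (b i))"
      using k b_res by simp
    then have "k mod Q = 0"
      using cyclic_funpow_eq_iff[OF cyc bX, of k i 0] by (simp add: Q_def)
    then obtain l where "k = l * Q" by (metis dvd_def mod_eq_0_iff_dvd mult.commute)
    then have "l * c + i = j" using k b_shift b_eqD by metis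
    then show ?thesis using ij by (cases l) auto
  qed
  define C where "C = (\<lambda>i. orbit XX S (b i)) ` {..<c}"
  have "inj_on (\<lambda>i. orbit XX S (b i)) {..<c}"
  proof (rule inj_onI)
    fix i j assume ij: "i \<in> {..<c}" "j \<in> {..<c}" and eq: "orbit XX S (b i) = orbit XX S (b j)"
    have "b j \<in> orbit XX S (b i)" using orbit_refl[OF S_bij bX] eq by simp
    then obtain k l where kl: "(S ^^ k) (b i) = (S ^^ l) (b j)"
      using mem_orbit_iff[OF S_bij bX] by blast
    show "i = j"
    proof (cases "l \<le> k")
      case True
      then have "(S ^^ l) ((S ^^ (k - l)) (b i)) = (S ^^ l) (b j)"
        using kl by (metis funpow_add le_add_diff_inverse o_apply)
      then have "(S ^^ (k - l)) (b i) = b j"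
        using S_pow_cancel[OF S_pow_mem[OF bX] bX] by blast
      then show ?thesis using distinct ij by auto
    next
      case False
      then have "(S ^^ k) ((S ^^ (l - k)) (b j)) = (S ^^ k) (b i)"
        using kl by (metis funpow_add le_add_diff_inverse nat_le_linear o_apply)
      then have "(S ^^ (l - k)) (b j) = b i"
        using S_pow_cancel[OF S_pow_mem[OF bX] bX] by blast
      then show ?thesis using distinct[of j i] ij by auto
    qed
  qed
  then have cardC: "card C = c" by (simp add: C_def card_image)
  have "orbit XX T x = \<Union>C"
  proof (intro set_eqI iffI)
    fix y assume "y \<in> \<Union>C"
    then obtain i where i: "y \<in> orbit XX S (b i)" by (auto simp: C_def)
    then obtain k l where y: "y \<in> X" and kl: "(S ^^ k) (b i) = (S ^^ l) y"
      using mem_orbit_iff[OF S_bij bX] by blast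
    have "(T ^^ (displacement k (b i) + i * Q)) x = (T ^^ displacement l y) y"
      using kl S_pow_eq[OF bX] S_pow_eq[OF y] by (simp add: funpow_add b_def)
    then show "y \<in> orbit XX T x" using mem_orbit_iff[OF T_bij x] y by blast
  next
    fix y assume "y \<in> orbit XX T x"
    then obtain a d where y: "y \<in> X" and ad: "(T ^^ a) x = (T ^^ d) y"
      using mem_orbit_iff[OF T_bij x] by blast
    obtain j where j: "residue n ((S ^^ j) y) = residue n x"
      using cyclic_reaches[OF cyc y x] by blast
    \<comment> \<open>The point \<open>w\<close> is in the \<open>S\<close>-orbit of \<open>y\<close> and has the residue of \<open>x\<close>.\<close>
    define w where "w = (S ^^ j) y"
    have w: "w \<in> X" using S_pow_mem[OF y] by (simp add: w_def)
    define e where "e = displacement j y"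
    have "(T ^^ d) w = (T ^^ e) ((T ^^ d) y)"
      using S_pow_eq[OF y] funpow_apply_commute[of d T e y] by (simp add: w_def e_def)
    also have "\<dots> = (T ^^ (e + a)) x" using ad by (simp add: funpow_add)
    finally have wx: "(T ^^ (e + a)) x = (T ^^ d) w" ..
    have "(residue n x + (e + a)) mod Q = (residue n x + d) mod Q"
      using wx residue_T_pow[OF x, of n "e + a"] residue_T_pow[OF w, of n d] j
      by (simp add: Q_def flip: w_def)
    then have md: "(e + a) mod Q = d mod Q" by (simp add: nat_mod_eq_iff add.assoc)
    have "\<exists>i<c. \<exists>k l. (S ^^ k) (b i) = (S ^^ l) w"
    proof (cases "d \<le> e + a")
      case True
      then have "(T ^^ d) ((T ^^ (e + a - d)) x) = (T ^^ d) w"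
        using wx by (metis funpow_add le_add_diff_inverse o_apply)
      then have eq: "w = (T ^^ (e + a - d)) x"
        using funpow_cancel[OF T_inj T_Pi T_pow_mem[OF x] w] by metis
      obtain q where "e + a - d = q * Q"
        using md True by (metis dvd_def mod_eq_dvd_iff_nat mult.commute)
      then have "w = b q" using eq by (simp add: b_def)
      also have "\<dots> = b (q div c * c + q mod c)" by simp
      also have "\<dots> = (S ^^ (q div c * Q)) (b (q mod c))" by (rule b_shift[symmetric])
      finally have "(S ^^ (q div c * Q)) (b (q mod c)) = (S ^^ 0) w" by simp
      then show ?thesis using c by (meson mod_less_divisor)
    next
      case False
      then have "(T ^^ (e + a)) ((T ^^ (d - (e + a))) w) = (T ^^ (e + a)) x"
        using wx by (metis funpow_add le_add_diff_inverse nat_le_linear o_apply)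
      then have eq: "x = (T ^^ (d - (e + a))) w"
        using funpow_cancel[OF T_inj T_Pi T_pow_mem[OF w] x] by metis
      obtain q where q: "d - (e + a) = q * Q"
        using md False by (metis dvd_def mod_eq_dvd_iff_nat mult.commute nat_le_linear)
      \<comment> \<open>Here \<open>w\<close> lies \<open>q * Q\<close> steps before \<open>x\<close>, so \<open>i\<close> has to be \<open>- q\<close> modulo \<open>c\<close>.\<close>
      define i where "i = (c - q mod c) mod c"
      have "(i + q) mod c = 0"
      proof -
        have "(i + q) mod c = (c - q mod c + q mod c) mod c"
          unfolding i_def by (metis mod_add_left_eq mod_add_right_eq)
        then show ?thesis using c by (simp add: less_imp_le)
      qed
      then obtain k where k: "i + q = k * c" by (metis dvd_def mod_eq_0_iff_dvd mult.commute)
      have "b i = (T ^^ ((i + q) * Q)) w"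
        unfolding b_def by (subst eq) (simp add: q funpow_add distrib_right)
      also have "\<dots> = (S ^^ (k * Q)) w" using shift[OF w, of k] k by simp
      finally have "(S ^^ 0) (b i) = (S ^^ (k * Q)) w" by simp
      moreover have "i < c" using c by (simp add: i_def)
      ultimately show ?thesis by blast
    qed
    then obtain i k l where i: "i < c" and kl: "(S ^^ k) (b i) = (S ^^ l) w" by blast
    have "(S ^^ k) (b i) = (S ^^ (l + j)) y" using kl by (simp add: w_def funpow_add)
    then have "y \<in> orbit XX S (b i)" using mem_orbit_iff[OF S_bij bX] y by blast
    then show "y \<in> \<Union>C" using i by (auto simp: C_def)
  qed
  moreover have "C \<subseteq> orbit XX S ` X" using bX by (auto simp: C_def)
  ultimately show "\<exists>C\<subseteq>orbit XX S ` X. finite C \<and> card C = c \<and> orbit XX T x = \<Union>C"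
    using cardC by (intro exI[of _ C]) (auto simp: C_def)
qed

section \<open>Conjugacy and coboundary for the speedup\<close>

lemma speedup_conjugate_and_coboundary:
  "topologically_conjugate XX S XX T \<and>
    coboundary XX S (\<lambda>x. real (p x) - real (orbit_number XX T S))"
proof -
  obtain N where N: "\<And>x y. x \<in> X \<Longrightarrow> y \<in> X \<Longrightarrow> residue N x = residue N y \<Longrightarrow> p x = p y"
    using jump_level by blast
  have cyc: "cyclic_at n S" if "N \<le> n" for n
    by (rule S_cyclic) (use N residue_eq_mono that in blast)
  have conj: "topologically_conjugate XX S XX T"
    by (rule cyclic_conjugate[of N]) (use cyc T_cyclic in auto)
  note cycN = cyc[OF order_refl]
  obtain c where c: "0 < c" and per: "\<And>x. x \<in> X \<Longrightarrow> displacement (modulus N) x = c * modulus N"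
    using displacement_period[OF cycN N] by blast
  have ne: "X \<noteq> {}" using zero_mem_X by blast
  have num: "orbit_number XX T S = c"
    by (rule orbit_number_eqI[OF S_bij ne orbit_number_of_period[OF cycN c per]])
  have "coboundary XX S (\<lambda>x. real (p x) - real c)"
  proof (rule coboundary_of_zero_cycle_sum[OF cycN])
    show "real (p x) - real c = real (p y) - real c"
      if "x \<in> X" "y \<in> X" "residue N x = residue N y" for x y
      by (simp only: N[OF that])
  next
    fix x assume x: "x \<in> X"
    have "(\<Sum>j<modulus N. real (p ((S ^^ j) x)) - real c) = real (displacement (modulus N) x) - real (c * modulus N)"
      by (simp add: displacement_def sum_subtractf)
    then show "(\<Sum>j<modulus N. real (p ((S ^^ j) x)) - real c) = 0" using per[OF x] by simp
  qed
  then show ?thesis using conj num by simp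
qed

end

theorem theorem3p3:
  fixes \<alpha> :: "nat \<Rightarrow> nat" and p :: "(nat \<Rightarrow> nat) \<Rightarrow> nat" and S :: "(nat \<Rightarrow> nat) \<Rightarrow> nat \<Rightarrow> nat"
  assumes alpha: "\<And>i. 2 \<le> \<alpha> i"
    and p_pos: "\<And>x. x \<in> topspace (odometer_space \<alpha>) \<Longrightarrow> 0 < p x"
    and p_bounded: "bdd_above (p ` topspace (odometer_space \<alpha>))"
    and S_eq: "\<And>x. x \<in> topspace (odometer_space \<alpha>) \<Longrightarrow> S x = (odometer \<alpha> ^^ p x) x"
    and S_homeo: "homeomorphic_map (odometer_space \<alpha>) (odometer_space \<alpha>) S"
    and S_minimal: "minimal_homeomorphism (odometer_space \<alpha>) S"
  shows "topologically_conjugate (odometer_space \<alpha>) S (odometer_space \<alpha>) (odometer \<alpha>) \<and>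
    coboundary (odometer_space \<alpha>) S
      (\<lambda>x. real (p x) - real (orbit_number (odometer_space \<alpha>) (odometer \<alpha>) S))"
proof -
  interpret speedup \<alpha> p S
    using assms by unfold_locales
  show ?thesis by (rule speedup_conjugate_and_coboundary)
qed

end
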